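(* Let $k\ge 1$, let $\mathscr{X}$ be a higher rank $k$-graph with functor $\delta\colon\mathscr{X}\to\mathbb{N}^k$, and let there be a size-preserving Zappa-Szép action of the groupoid $G$ on $\mathscr{X}$. Define $\lambda\colon\mathscr{X}\bowtie G\to\mathbb{N}^k$ by $\lambda(x,g)=\delta(x)$. Then $\lambda$ is a well-defined functor, and $\mathscr{X}\bowtie G$, equipped with $\lambda$, is a generalized higher rank $k$-graph satisfying the $\mathscr{R}$-condition.
   Context: Categories are small and regarded as sets of arrows, with identities identified with objects; $C_o$ denotes the set of identities of $C$. $\mathbf{d}(x)$ and $\mathbf{r}(x)$ are the identities with $x\mathbf{d}(x)$ and $\mathbf{r}(x)x$ defined; $xy$ exists if and only if $\mathbf{d}(x)=\mathbf{r}(y)$. An element $x$ is invertible if there is $x^{-1}$ with $x^{-1}x=\mathbf{d}(x)$ and $xx^{-1}=\mathbf{r}(x)$. $\mathbb{N}=\{0,1,2,\dots\}$; $\mathbb{N}^k$ is the additive monoid regarded as a one-object category, with identity $\mathbf{0}$. Higher rank $k$-graph: a category $\mathscr{X}$ with a functor $\delta\colon\mathscr{X}\to\mathbb{N}^k$ having the unique factorization property: if $\delta(a)=\mathbf{m}+\mathbf{n}$ then there exist unique $b,c\in\mathscr{X}$ with $a=bc$, $\delta(b)=\mathbf{m}$, $\delta(c)=\mathbf{n}$ (no countability assumed). Zappa-Szép action: let $\mathscr{X}$ be a category and $G$ a groupoid with $G_o=\mathscr{X}_o$. A Zappa-Szép action of $G$ on $\mathscr{X}$ consists of assignments $(g,x)\mapsto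 g\cdot x\in\mathscr{X}$ and $(g,x)\mapsto g|_x\in G$, defined for $g\in G$, $x\in\mathscr{X}$ with $\mathbf{d}(g)=\mathbf{r}(x)$, such that the following hold whenever the expressions make sense: (C1) $\mathbf{r}(g\cdot x)=\mathbf{r}(g)$; (C2) $\mathbf{d}(g\cdot x)=\mathbf{r}(g|_x)$; (C3) $\mathbf{d}(x)=\mathbf{d}(g|_x)$; (SS1) $\mathbf{r}(x)\cdot x=x$; (SS2) $(gh)\cdot x=g\cdot(h\cdot x)$; (SS3) $g\cdot\mathbf{d}(g)=\mathbf{r}(g)$; (SS4) $\mathbf{r}(x)|_x=\mathbf{d}(x)$; (SS5) $g|_{\mathbf{d}(g)}=g$; (SS6) $g|_{xy}=(g|_x)|_y$; (SS7) $(gh)|_x=g|_{h\cdot x}\,h|_x$; (SS8) $g\cdot(xy)=(g\cdot x)(g|_x\cdot y)$. When $\mathscr{X}$ is a higher rank $k$-graph, the action is size-preserving if $\delta(g\cdot x)=\delta(x)$ whenever $g\cdot x$ is defined. The category $\mathscr{X}\bowtie G$ is the set of ordered pairs $(x,g)$ with $x\in\mathscr{X}$, $g\in G$, $\mathbf{d}(x)=\mathbf{r}(g)$, with $\mathbf{d}(x,g)=(\mathbf{d}(g),\mathbf{d}(g))$, $\mathbf{r}(x,g)=(\mathbf{r}(x),\mathbf{r}(x))$, product $(x,g)(y,h)=(x(g\cdot y),g|_yh)$ when $\mathbf{d}(x,g)=\mathbf{r}(y,h)$, and identities $(e,e)$, $e\in G_o=\mathscr{X}_o$. Generalized higher rank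 $k$-graph: a category $C$ equipped with a size functor $\lambda\colon C\to\mathbb{N}^k$ (a functor such that $\lambda^{-1}(\mathbf{0})$ consists of all and only the invertible elements of $C$) satisfying the Weak Factorization Property: whenever $\lambda(a)=\mathbf{m}+\mathbf{n}$, there exist $a_1,a_2\in C$ with $a=a_1a_2$, $\lambda(a_1)=\mathbf{m}$, $\lambda(a_2)=\mathbf{n}$, such that if $a=b_1b_2$ with $\lambda(b_1)=\mathbf{m}$ and $\lambda(b_2)=\mathbf{n}$ then $b_1=a_1g$ and $b_2=g^{-1}a_2$ for some invertible $g$. $\mathscr{R}$-condition: for $a\in C$ let $aC=\{ax: x\in C,\ ax\text{ exists}\}\subseteq\mathbf{r}(a)C$; $aC$ is called maximal if it is properly contained in $\mathbf{r}(a)C$ and is maximal (under inclusion) among the principal right ideals properly contained in $\mathbf{r}(a)C$. A transversal of the set of generators of the maximal principal right ideals is a set $X\subseteq C$ such that $xC$ is maximal for each $x\in X$ and each maximal principal right ideal equals $xC$ for exactly one $x\in X$. The wide subcategory $\langle X\rangle$ generated by $X$ consists of all identities of $C$ and all defined finite products of elements of $X$. $C$ satisfies the $\mathscr{R}$-condition if, for some choice of such a transversal $X$: whenever $u,v\in\langle X\rangle$ and $g$ is an invertible element of $C$ with $u=vg$, then $u=v$ and $g$ is an identity. *)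

theory Defs
  imports "HOL-Analysis.Finite_Cartesian_Product"
begin

text \<open>
  A small category is a set of arrows in which every object is identified with its
  identity arrow, so \<open>dm\<close> (the paper's d) and \<open>rn\<close> (the paper's r) are arrow-valued.
  The operations are total functions on the ambient type; the product \<open>cmp C x y\<close> is
  meaningful only for arrows with \<open>dm C x = rn C y\<close>.
\<close>

record 'a cat =
  arr :: "'a set"
  dm  :: "'a \<Rightarrow> 'a"
  rn  :: "'a \<Rightarrow> 'a"
  cmp :: "'a \<Rightarrow> 'a \<Rightarrow> 'a"

definition composable :: "'a cat \<Rightarrow> 'a \<Rightarrow> 'a \<Rightarrow> bool" where
  "composable C x y \<longleftrightarrow> x \<in> arr C \<and> y \<in> arr C \<and> dm C x = rn C y"

definition identities :: "'a cat \<Rightarrow> 'a set" where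
  "identities C = {e \<in> arr C. dm C e = e}"

locale category =
  fixes C :: "'a cat"
  assumes dm_arr: "x \<in> arr C \<Longrightarrow> dm C x \<in> arr C"
    and rn_arr: "x \<in> arr C \<Longrightarrow> rn C x \<in> arr C"
    and dm_dm: "x \<in> arr C \<Longrightarrow> dm C (dm C x) = dm C x"
    and rn_dm: "x \<in> arr C \<Longrightarrow> rn C (dm C x) = dm C x"
    and dm_rn: "x \<in> arr C \<Longrightarrow> dm C (rn C x) = rn C x"
    and rn_rn: "x \<in> arr C \<Longrightarrow> rn C (rn C x) = rn C x"
    and cmp_dm: "x \<in> arr C \<Longrightarrow> cmp C x (dm C x) = x"
    and rn_cmp_self: "x \<in> arr C \<Longrightarrow> cmp C (rn C x) x = x"
    and cmp_arr: "composable C x y \<Longrightarrow> cmp C x y \<in> arr C"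
    and dm_cmp: "composable C x y \<Longrightarrow> dm C (cmp C x y) = dm C y"
    and rn_cmp: "composable C x y \<Longrightarrow> rn C (cmp C x y) = rn C x"
    and assoc: "composable C x y \<Longrightarrow> composable C y z \<Longrightarrow>
                  cmp C (cmp C x y) z = cmp C x (cmp C y z)"

lemma (in category) identities_iff_unit:
  "e \<in> identities C \<longleftrightarrow>
     e \<in> arr C \<and> (\<forall>x. composable C e x \<longrightarrow> cmp C e x = x) \<and>
     (\<forall>x. composable C x e \<longrightarrow> cmp C x e = x)"
proof
  assume "e \<in> identities C"
  then have e: "e \<in> arr C" "dm C e = e" by (auto simp: identities_def)
  then have "rn C e = e" using rn_dm by metis
  with e show "e \<in> arr C \<and> (\<forall>x. composable C e x \<longrightarrow> cmp C e x = x) \<and>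
     (\<forall>x. composable C x e \<longrightarrow> cmp C x e = x)"
    by (metis composable_def cmp_dm rn_cmp_self)
next
  assume e: "e \<in> arr C \<and> (\<forall>x. composable C e x \<longrightarrow> cmp C e x = x) \<and>
     (\<forall>x. composable C x e \<longrightarrow> cmp C x e = x)"
  then have "composable C e (dm C e)" by (auto simp: composable_def dm_arr rn_dm)
  with e have "dm C e = e" by (metis cmp_dm)
  with e show "e \<in> identities C" by (simp add: identities_def)
qed

definition inverse_of :: "'a cat \<Rightarrow> 'a \<Rightarrow> 'a \<Rightarrow> bool" where
  "inverse_of C x y \<longleftrightarrow>
     composable C y x \<and> cmp C y x = dm C x \<and> composable C x y \<and> cmp C x y = rn C x"

definition invertible :: "'a cat \<Rightarrow> 'a \<Rightarrow> bool" where
  "invertible C x \<longleftrightarrow> x \<in> arr C \<and> (\<exists>y. inverse_of C x y)"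

locale groupoid = category +
  assumes all_invertible: "x \<in> arr C \<Longrightarrow> invertible C x"

text \<open>
  Functors into the additive monoid of \<open>k\<close>-tuples of natural numbers, viewed as a category
  with one object. The index type \<open>'k\<close> is finite and nonempty, so \<open>CARD('k)\<close> is an arbitrary
  \<open>k \<ge> 1\<close>.
\<close>

locale degree_functor = category C for C :: "'a cat" +
  fixes \<delta> :: "'a \<Rightarrow> nat ^ ('k::finite)"
  assumes degree_identity: "e \<in> identities C \<Longrightarrow> \<delta> e = 0"
    and degree_cmp: "composable C x y \<Longrightarrow> \<delta> (cmp C x y) = \<delta> x + \<delta> y"

locale higher_rank_graph = degree_functor C \<delta>
  for C :: "'a cat" and \<delta> :: "'a \<Rightarrow> nat ^ ('k::finite)" +
  assumes unique_factorization:
    "a \<in> arr C \<Longrightarrow> \<delta> a = m + n \<Longrightarrow>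
       \<exists>!p. case p of (b, c) \<Rightarrow>
         composable C b c \<and> a = cmp C b c \<and> \<delta> b = m \<and> \<delta> c = n"

text \<open>
  \<open>act g x\<close> is the left action of \<open>g\<close> on \<open>x\<close> and \<open>res g x\<close> the restriction of \<open>g\<close> to \<open>x\<close>;
  both are meaningful only for \<open>dm G g = rn X x\<close>. The two categories live in one ambient
  type because they share their identities.
\<close>

definition zs_defined :: "'a cat \<Rightarrow> 'a cat \<Rightarrow> 'a \<Rightarrow> 'a \<Rightarrow> bool" where
  "zs_defined X G g x \<longleftrightarrow> g \<in> arr G \<and> x \<in> arr X \<and> dm G g = rn X x"

locale zappa_szep_action = X: category X + G: groupoid G
  for X G :: "'a cat" +
  fixes act res :: "'a \<Rightarrow> 'a \<Rightarrow> 'a"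
  assumes same_identities: "identities G = identities X"
    and act_arr: "zs_defined X G g x \<Longrightarrow> act g x \<in> arr X"
    and res_arr: "zs_defined X G g x \<Longrightarrow> res g x \<in> arr G"
    and C1: "zs_defined X G g x \<Longrightarrow> rn X (act g x) = rn G g"
    and C2: "zs_defined X G g x \<Longrightarrow> dm X (act g x) = rn G (res g x)"
    and C3: "zs_defined X G g x \<Longrightarrow> dm X x = dm G (res g x)"
    and SS1: "x \<in> arr X \<Longrightarrow> act (rn X x) x = x"
    and SS2: "composable G g h \<Longrightarrow> zs_defined X G h x \<Longrightarrow>
                act (cmp G g h) x = act g (act h x)"
    and SS3: "g \<in> arr G \<Longrightarrow> act g (dm G g) = rn G g"
    and SS4: "x \<in> arr X \<Longrightarrow> res (rn X x) x = dm X x"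
    and SS5: "g \<in> arr G \<Longrightarrow> res g (dm G g) = g"
    and SS6: "zs_defined X G g x \<Longrightarrow> composable X x y \<Longrightarrow>
                res g (cmp X x y) = res (res g x) y"
    and SS7: "composable G g h \<Longrightarrow> zs_defined X G h x \<Longrightarrow>
                res (cmp G g h) x = cmp G (res g (act h x)) (res h x)"
    and SS8: "zs_defined X G g x \<Longrightarrow> composable X x y \<Longrightarrow>
                act g (cmp X x y) = cmp X (act g x) (act (res g x) y)"

definition size_preserving ::
    "'a cat \<Rightarrow> 'a cat \<Rightarrow> ('a \<Rightarrow> nat ^ ('k::finite)) \<Rightarrow> ('a \<Rightarrow> 'a \<Rightarrow> 'a) \<Rightarrow> bool" where
  "size_preserving X G \<delta> act \<longleftrightarrow> (\<forall>g x. zs_defined X G g x \<longrightarrow> \<delta> (act g x) = \<delta> x)"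

definition zs_product ::
    "'a cat \<Rightarrow> 'a cat \<Rightarrow> ('a \<Rightarrow> 'a \<Rightarrow> 'a) \<Rightarrow> ('a \<Rightarrow> 'a \<Rightarrow> 'a) \<Rightarrow> ('a \<times> 'a) cat" where
  "zs_product X G act res =
     \<lparr>arr = {(x, g). x \<in> arr X \<and> g \<in> arr G \<and> dm X x = rn G g},
      dm = (\<lambda>(x, g). (dm G g, dm G g)),
      rn = (\<lambda>(x, g). (rn X x, rn X x)),
      cmp = (\<lambda>(x, g) (y, h). (cmp X x (act g y), cmp G (res g y) h))\<rparr>"

definition zs_size :: "('a \<Rightarrow> nat ^ ('k::finite)) \<Rightarrow> 'a \<times> 'a \<Rightarrow> nat ^ 'k" where
  "zs_size \<delta> = (\<lambda>(x, g). \<delta> x)"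

locale size_functor = degree_functor C \<delta>
  for C :: "'a cat" and \<delta> :: "'a \<Rightarrow> nat ^ ('k::finite)" +
  assumes size_zero_iff: "a \<in> arr C \<Longrightarrow> \<delta> a = 0 \<longleftrightarrow> invertible C a"

locale generalized_higher_rank_graph = size_functor C \<delta>
  for C :: "'a cat" and \<delta> :: "'a \<Rightarrow> nat ^ ('k::finite)" +
  assumes weak_factorization:
    "a \<in> arr C \<Longrightarrow> \<delta> a = m + n \<Longrightarrow>
       \<exists>a1 a2. composable C a1 a2 \<and> a = cmp C a1 a2 \<and> \<delta> a1 = m \<and> \<delta> a2 = n \<and>
         (\<forall>b1 b2. composable C b1 b2 \<and> a = cmp C b1 b2 \<and> \<delta> b1 = m \<and> \<delta> b2 = n \<longrightarrow>
            (\<exists>g h. inverse_of C g h \<and>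
               composable C a1 g \<and> b1 = cmp C a1 g \<and>
               composable C h a2 \<and> b2 = cmp C h a2))"

definition right_ideal :: "'a cat \<Rightarrow> 'a \<Rightarrow> 'a set" where
  "right_ideal C a = {cmp C a x | x. composable C a x}"

definition maximal_at :: "'a cat \<Rightarrow> 'a \<Rightarrow> bool" where
  "maximal_at C a \<longleftrightarrow> a \<in> arr C \<and>
     right_ideal C a \<subset> right_ideal C (rn C a) \<and>
     (\<forall>b \<in> arr C. right_ideal C b \<subset> right_ideal C (rn C a) \<longrightarrow>
        right_ideal C a \<subseteq> right_ideal C b \<longrightarrow> right_ideal C b = right_ideal C a)"

definition transversal :: "'a cat \<Rightarrow> 'a set \<Rightarrow> bool" where
  "transversal C T \<longleftrightarrow> T \<subseteq> arr C \<and> (\<forall>x \<in> T. maximal_at C x) \<and>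
     (\<forall>a. maximal_at C a \<longrightarrow> (\<exists>!x. x \<in> T \<and> right_ideal C x = right_ideal C a))"

inductive_set wide_subcategory :: "'a cat \<Rightarrow> 'a set \<Rightarrow> 'a set"
  for C :: "'a cat" and T :: "'a set" where
  identity: "e \<in> identities C \<Longrightarrow> e \<in> wide_subcategory C T"
| generator: "x \<in> T \<Longrightarrow> x \<in> wide_subcategory C T"
| product: "u \<in> wide_subcategory C T \<Longrightarrow> v \<in> wide_subcategory C T \<Longrightarrow> composable C u v \<Longrightarrow>
    cmp C u v \<in> wide_subcategory C T"

definition R_condition :: "'a cat \<Rightarrow> bool" where
  "R_condition C \<longleftrightarrow>
     (\<exists>T. transversal C T \<and>
        (\<forall>u \<in> wide_subcategory C T. \<forall>v \<in> wide_subcategory C T. \<forall>g.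
           invertible C g \<and> composable C v g \<and> u = cmp C v g \<longrightarrow>
             u = v \<and> g \<in> identities C))"

end

theory Submission
  imports Defs
begin

text \<open>
  Since \<open>\<X>\<close> has no invertibles besides its identities, the principal right ideal of
  \<open>(x, g)\<close> consists of the pairs whose first entry lies in \<open>x\<X>\<close>, so it determines \<open>x\<close> and
  does not see \<open>g\<close>. The pairs \<open>(x, d(x))\<close> therefore represent all principal right ideals; they
  are closed under products, and multiplying one by an invertible \<open>(e, h)\<close> only changes the
  second entry to \<open>h\<close>. This gives the \<open>\<R>\<close>-condition. The weak factorizations of \<open>(x, g)\<close> come
  from the factorization \<open>x = bc\<close> as \<open>(b, d(b))(c, g)\<close>, and another factorization
  \<open>(b, h)(z, k)\<close> differs from it by the invertible \<open>(d(b), h)\<close>.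
\<close>

section \<open>Identities as domains and ranges\<close>

context category
begin

lemma identities_dm: "x \<in> arr C \<Longrightarrow> dm C x \<in> identities C"
  by (simp add: identities_def dm_arr dm_dm)

lemma identities_rn: "x \<in> arr C \<Longrightarrow> rn C x \<in> identities C"
  by (simp add: identities_def rn_arr dm_rn)

lemma identitiesD:
  assumes "e \<in> identities C"
  shows "e \<in> arr C" "dm C e = e" "rn C e = e"
  using assms rn_dm[of e] by (auto simp: identities_def)

end

section \<open>Degree zero and principal right ideals in a higher rank graph\<close>

lemma vec_add_eq_self: "(a :: nat ^ 'n) = a + b + c \<Longrightarrow> b = 0"
  by (simp add: vec_eq_iff)

context higher_rank_graph
begin

lemma factorization_unique:
  assumes "composable C b c" "composable C b' c'" "cmp C b c = cmp C b' c'"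
    and "\<delta> b = \<delta> b'" "\<delta> c = \<delta> c'"
  shows "b = b' \<and> c = c'"
proof -
  have "cmp C b c \<in> arr C" "\<delta> (cmp C b c) = \<delta> b + \<delta> c"
    using assms by (auto intro: cmp_arr degree_cmp)
  then have "\<exists>!p. case p of (b1, c1) \<Rightarrow>
      composable C b1 c1 \<and> cmp C b c = cmp C b1 c1 \<and> \<delta> b1 = \<delta> b \<and> \<delta> c1 = \<delta> c"
    by (rule unique_factorization)
  then have "(b, c) = (b', c')"
    by (rule ex1E) (use assms in \<open>metis (mono_tags, lifting) case_prodI\<close>)
  then show ?thesis by simp
qed

text \<open>An arrow \<open>x\<close> of degree 0 factors both as \<open>x\<close> times
  \<open>dm C x\<close> and as \<open>rn C x\<close> times \<open>x\<close>, with all four factors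
  of degree 0; by uniqueness the factors agree.\<close>

lemma identity_if_degree_0:
  assumes "x \<in> arr C" "\<delta> x = 0"
  shows "x \<in> identities C"
proof -
  have "x = rn C x \<and> dm C x = x"
    by (rule factorization_unique)
      (use assms in \<open>auto simp: composable_def dm_arr rn_arr dm_rn rn_dm cmp_dm rn_cmp_self
        degree_identity[OF identities_dm] degree_identity[OF identities_rn]\<close>)
  with assms show ?thesis by (simp add: identities_def)
qed

text \<open>Each of \<open>x\<close> and \<open>y\<close> is a right multiple of the other, so the
  degrees of the two multipliers cancel. A multiplier of degree 0 is an identity.\<close>

lemma right_ideal_inject:
  assumes "x \<in> arr C" "y \<in> arr C" "right_ideal C x = right_ideal C y"
  shows "x = y"
proof -
  have self: "z \<in> right_ideal C z" if "z \<in> arr C" for z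
    unfolding right_ideal_def using that
    by (intro CollectI exI[of _ "dm C z"]) (simp add: composable_def dm_arr rn_dm cmp_dm)
  have "x \<in> right_ideal C y" "y \<in> right_ideal C x"
    using self[OF assms(1)] self[OF assms(2)] by (simp_all only: assms(3))
  then obtain u v where u: "composable C y u" "x = cmp C y u"
    and v: "composable C x v" "y = cmp C x v"
    unfolding right_ideal_def by blast
  have "\<delta> x = \<delta> x + \<delta> v + \<delta> u"
    using degree_cmp[OF u(1)] degree_cmp[OF v(1)] by (simp flip: u(2) v(2))
  then have "v \<in> identities C"
    using v(1) by (auto intro: identity_if_degree_0 vec_add_eq_self simp: composable_def)
  then show ?thesis
    using v by (metis identities_iff_unit)
qed

end

section \<open>The product category, its identities, inverses and right ideals\<close>

context zappa_szep_action
begin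

lemma dm_X_in_G [simp]:
  assumes "x \<in> arr X"
  shows "dm X x \<in> arr G" "dm G (dm X x) = dm X x" "rn G (dm X x) = dm X x"
  using G.identitiesD[of "dm X x"] X.identities_dm[OF assms] by (simp_all add: same_identities)

lemma rn_X_in_G [simp]:
  assumes "x \<in> arr X"
  shows "rn X x \<in> arr G" "dm G (rn X x) = rn X x" "rn G (rn X x) = rn X x"
  using G.identitiesD[of "rn X x"] X.identities_rn[OF assms] by (simp_all add: same_identities)

lemma dm_G_in_X [simp]:
  assumes "g \<in> arr G"
  shows "dm G g \<in> arr X" "dm X (dm G g) = dm G g" "rn X (dm G g) = dm G g"
  using X.identitiesD[of "dm G g"] G.identities_dm[OF assms] by (simp_all add: same_identities)

lemma rn_G_in_X [simp]:
  assumes "g \<in> arr G"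
  shows "rn G g \<in> arr X" "dm X (rn G g) = rn G g" "rn X (rn G g) = rn G g"
  using X.identitiesD[of "rn G g"] G.identities_rn[OF assms] by (simp_all add: same_identities)

lemmas category_simps [simp] =
  X.dm_arr X.rn_arr X.dm_dm X.rn_dm X.dm_rn X.rn_rn X.cmp_dm X.rn_cmp_self
  G.dm_arr G.rn_arr G.dm_dm G.rn_dm G.dm_rn G.rn_rn G.cmp_dm G.rn_cmp_self

lemma cmp_rn_G [simp]: "x \<in> arr X \<Longrightarrow> dm X x = rn G g \<Longrightarrow> cmp X x (rn G g) = x"
  using X.cmp_dm[of x] by simp

lemmas composable_simps [simp] =
  X.cmp_arr[unfolded composable_def] X.dm_cmp[unfolded composable_def]
  X.rn_cmp[unfolded composable_def]
  G.cmp_arr[unfolded composable_def] G.dm_cmp[unfolded composable_def]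
  G.rn_cmp[unfolded composable_def]

lemmas action_simps [simp] =
  act_arr[unfolded zs_defined_def] res_arr[unfolded zs_defined_def]
  C1[unfolded zs_defined_def] C2[unfolded zs_defined_def]
  C3[unfolded zs_defined_def, symmetric] SS1 SS3 SS4 SS5

abbreviation P :: "('a \<times> 'a) cat" where
  "P \<equiv> zs_product X G act res"

lemma arr_P [simp]: "(x, g) \<in> arr P \<longleftrightarrow> x \<in> arr X \<and> g \<in> arr G \<and> dm X x = rn G g"
  and dm_P [simp]: "dm P (x, g) = (dm G g, dm G g)"
  and rn_P [simp]: "rn P (x, g) = (rn X x, rn X x)"
  and cmp_P [simp]: "cmp P (x, g) (y, h) = (cmp X x (act g y), cmp G (res g y) h)"
  by (simp_all add: zs_product_def)

lemma composable_P:
  "composable P (x, g) (y, h) \<longleftrightarrow>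
     (x \<in> arr X \<and> g \<in> arr G \<and> dm X x = rn G g) \<and>
     (y \<in> arr X \<and> h \<in> arr G \<and> dm X y = rn G h) \<and> dm G g = rn X y"
  by (auto simp: composable_def)

text \<open>After expansion, SS8 and SS2 match the first entries of the two bracketings, and SS6 and
  SS7 match the second entries. What remains is associativity in \<open>X\<close> and in
  \<open>G\<close>.\<close>

lemma assoc_P:
  assumes "composable P p q" "composable P q r"
  shows "cmp P (cmp P p q) r = cmp P p (cmp P q r)"
proof -
  obtain x g y h z k where [simp]: "p = (x, g)" "q = (y, h)" "r = (z, k)"
    by (metis prod.exhaust)
  note mem = assms[simplified composable_P]
  have "act g (cmp X y (act h z)) = cmp X (act g y) (act (cmp G (res g y) h) z)"
    using mem by (simp add: SS8 SS2 zs_defined_def composable_def)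
  moreover have "res g (cmp X y (act h z)) = res (res g y) (act h z)"
    using mem by (simp add: SS6 zs_defined_def composable_def)
  moreover have "res (cmp G (res g y) h) z = cmp G (res (res g y) (act h z)) (res h z)"
    using mem by (simp add: SS7 zs_defined_def composable_def)
  ultimately show ?thesis
    using mem by (simp add: X.assoc G.assoc composable_def)
qed

sublocale P: category P
proof
  fix p q r
  show "composable P p q \<Longrightarrow> composable P q r \<Longrightarrow> cmp P (cmp P p q) r = cmp P p (cmp P q r)"
    by (rule assoc_P)
qed (auto simp: composable_P zs_defined_def)

lemma identities_P: "identities P = (\<lambda>e. (e, e)) ` identities X"
proof (intro equalityI subsetI)
  fix p assume "p \<in> identities P"
  then obtain x g where "p = (x, g)" "g \<in> arr G" "x = dm G g" "g = dm G g"
    by (cases p) (auto simp: identities_def)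
  then show "p \<in> (\<lambda>e. (e, e)) ` identities X"
    using G.identities_dm[of g] by (auto simp: same_identities)
next
  fix p assume "p \<in> (\<lambda>e. (e, e)) ` identities X"
  then obtain e where "p = (e, e)" "e \<in> identities X" by auto
  moreover have "e \<in> identities G"
    using \<open>e \<in> identities X\<close> by (simp add: same_identities)
  ultimately show "p \<in> identities P"
    by (simp add: identities_def[of P] G.identitiesD X.identitiesD)
qed

text \<open>The pairs \<open>(rn G g, g)\<close> form a copy of \<open>G\<close>: by SS3 and SS5
  they multiply as their second entries do. Since \<open>dm G g = rn G h\<close>, the second pair is
  the copy of \<open>h\<close>.\<close>

lemma inverse_of_P:
  assumes "inverse_of G g h"
  shows "inverse_of P (rn G g, g) (dm G g, h)"
proof -
  have gh: "g \<in> arr G" "h \<in> arr G" "dm G g = rn G h" "dm G h = rn G g"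
      "cmp G h g = dm G g" "cmp G g h = rn G g"
    using assms by (auto simp: inverse_of_def composable_def)
  have "act h (dm G h) = rn G h" "res h (dm G h) = h"
    using gh(2) by simp_all
  moreover have "act g (dm G g) = rn G g" "res g (dm G g) = g"
    using gh(1) by simp_all
  moreover have "cmp X (rn G e) (rn G e) = rn G e" if "e \<in> arr G" for e
    using X.cmp_dm[of "rn G e"] that by simp
  ultimately show ?thesis
    using gh by (simp add: inverse_of_def composable_P)
qed

text \<open>Right multiples of \<open>(x, g)\<close> have first entries
  \<open>cmp X x (act g y)\<close>. Conversely, every \<open>y\<close> composable with
  \<open>x\<close> has the form \<open>act g (act h y)\<close> with \<open>h\<close> inverse to
  \<open>g\<close>, and the second entry can be prescribed because \<open>G\<close> is a
  groupoid.\<close>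

lemma right_ideal_P:
  assumes "(x, g) \<in> arr P"
  shows "right_ideal P (x, g) = {(w, k) \<in> arr P. w \<in> right_ideal X x}"
proof (intro equalityI subsetI)
  fix p assume "p \<in> right_ideal P (x, g)"
  then show "p \<in> {(w, k) \<in> arr P. w \<in> right_ideal X x}"
    by (force simp: right_ideal_def composable_P composable_def)
next
  fix p assume "p \<in> {(w, k) \<in> arr P. w \<in> right_ideal X x}"
  then obtain y k where p: "p = (cmp X x y, k)" "p \<in> arr P" "composable X x y"
    by (auto simp: right_ideal_def)
  obtain h where h: "h \<in> arr G" "dm G g = rn G h" "dm G h = rn G g" "cmp G g h = rn G g"
    using assms G.all_invertible[of g] by (auto simp: invertible_def inverse_of_def composable_def)
  have mem: "x \<in> arr X" "g \<in> arr G" "dm X x = rn G g" "y \<in> arr X" "rn X y = rn G g"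
      "k \<in> arr G" "dm X y = rn G k"
    using assms p by (auto simp: composable_def)
  \<comment> \<open>Here \<open>cmp G g h\<close> is the identity \<open>rn X y\<close>, which acts
    trivially on \<open>y\<close> and restricts to \<open>dm X y\<close>.\<close>
  have act: "act g (act h y) = y"
    using SS2[of g h y] SS1[of y] mem h by (simp add: composable_def zs_defined_def)
  have res: "cmp G (res g (act h y)) (res h y) = dm X y"
    using SS7[of g h y] SS4[of y] mem h by (simp add: composable_def zs_defined_def)
  have "p = cmp P (x, g) (act h y, cmp G (res h y) k)"
    using p mem h act res
    by (simp add: G.assoc[symmetric] composable_def)
  moreover have "composable P (x, g) (act h y, cmp G (res h y) k)"
    using mem h by (simp add: composable_P)
  ultimately show "p \<in> right_ideal P (x, g)"
    by (auto simp: right_ideal_def)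
qed

end

section \<open>Size functor and weak factorization\<close>

locale size_preserving_action = zappa_szep_action X G act res + X: higher_rank_graph X \<delta>
  for X G :: "'a cat"
    and act res :: "'a \<Rightarrow> 'a \<Rightarrow> 'a"
    and \<delta> :: "'a \<Rightarrow> nat ^ ('k::finite)" +
  assumes size_preserving: "size_preserving X G \<delta> act"
begin

lemma degree_act [simp]:
  "g \<in> arr G \<Longrightarrow> x \<in> arr X \<Longrightarrow> dm G g = rn X x \<Longrightarrow> \<delta> (act g x) = \<delta> x"
  using size_preserving by (auto simp: size_preserving_def zs_defined_def)

lemma zs_size [simp]: "zs_size \<delta> (x, g) = \<delta> x"
  by (simp add: zs_size_def)

sublocale P: degree_functor P "zs_size \<delta>"
proof
  fix e assume "e \<in> identities P"
  then show "zs_size \<delta> e = 0"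
    by (auto simp: identities_P X.degree_identity)
next
  fix p q assume "composable P p q"
  then show "zs_size \<delta> (cmp P p q) = zs_size \<delta> p + zs_size \<delta> q"
    by (cases p; cases q) (simp add: composable_P X.degree_cmp composable_def)
qed

text \<open>The sizes of an arrow and its inverse add up to 0, so both vanish because the entries
  are natural numbers. Conversely, a pair whose first entry is an identity lies in the copy of
  \<open>G\<close>.\<close>

lemma invertible_P_iff:
  assumes "(x, g) \<in> arr P"
  shows "invertible P (x, g) \<longleftrightarrow> x \<in> identities X"
proof
  assume "invertible P (x, g)"
  then obtain q where "inverse_of P (x, g) q"
    by (auto simp: invertible_def)
  then have "zs_size \<delta> (x, g) + zs_size \<delta> q = zs_size \<delta> (rn P (x, g))"
    using P.degree_cmp[of "(x, g)" q] by (simp add: inverse_of_def)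
  also have "\<dots> = 0"
    using P.degree_identity[OF P.identities_rn[OF assms]] .
  finally have "\<delta> x = 0"
    by (simp add: vec_eq_iff)
  then show "x \<in> identities X"
    using assms by (simp add: X.identity_if_degree_0)
next
  assume "x \<in> identities X"
  then have "x = rn G g"
    using assms X.identitiesD[of x] by simp
  then show "invertible P (x, g)"
    using assms G.all_invertible[of g] inverse_of_P by (auto simp: invertible_def)
qed

sublocale P: size_functor P "zs_size \<delta>"
proof
  fix p assume "p \<in> arr P"
  then show "zs_size \<delta> p = 0 \<longleftrightarrow> invertible P p"
    by (cases p) (use invertible_P_iff X.identity_if_degree_0 X.degree_identity in auto)
qed

text \<open>The identity \<open>dm X b\<close> acts trivially on \<open>c\<close> and restricts to
  \<open>dm X c\<close>, so a factorization of \<open>x\<close> lifts with \<open>g\<close> placed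
  in the right factor. The third claim compares every factorization of the same sizes with this
  lift.\<close>

lemma weak_factorization_P:
  assumes mem: "x \<in> arr X" "g \<in> arr G" "dm X x = rn G g"
    and bc: "composable X b c" "x = cmp X b c"
  shows "composable P (b, dm X b) (c, g)"
    and "(x, g) = cmp P (b, dm X b) (c, g)"
    and "composable P p q \<Longrightarrow> (x, g) = cmp P p q \<Longrightarrow> zs_size \<delta> p = \<delta> b \<Longrightarrow> zs_size \<delta> q = \<delta> c \<Longrightarrow>
      \<exists>u v. inverse_of P u v \<and> composable P (b, dm X b) u \<and> p = cmp P (b, dm X b) u \<and>
            composable P v (c, g) \<and> q = cmp P v (c, g)"
proof -
  have bc': "b \<in> arr X" "c \<in> arr X" "dm X b = rn X c" "dm X c = rn G g"
    using bc mem by (auto simp: composable_def)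
  then show "composable P (b, dm X b) (c, g)" "(x, g) = cmp P (b, dm X b) (c, g)"
    using mem bc(2) by (auto simp: composable_P)
  assume pq: "composable P p q" "(x, g) = cmp P p q" "zs_size \<delta> p = \<delta> b" "zs_size \<delta> q = \<delta> c"
  obtain y h z k where [simp]: "p = (y, h)" "q = (z, k)"
    by (metis prod.exhaust)
  have yz: "y \<in> arr X" "h \<in> arr G" "dm X y = rn G h" "z \<in> arr X" "k \<in> arr G" "dm X z = rn G k"
      "dm G h = rn X z" "x = cmp X y (act h z)" "g = cmp G (res h z) k"
    using pq by (auto simp: composable_P)
  \<comment> \<open>Size preservation gives \<open>act h z\<close> the degree of \<open>z\<close>,
    hence that of \<open>c\<close>, so uniqueness applies to the two factorizations of
    \<open>x\<close>.\<close>
  have "b = y \<and> c = act h z"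
    by (rule X.factorization_unique) (use bc bc' yz pq(3,4) in \<open>auto simp: composable_def\<close>)
  then have [simp]: "b = y" "c = act h z" by auto
  obtain j where inv: "inverse_of G h j"
    using G.all_invertible[of h] yz by (auto simp: invertible_def)
  then have j: "j \<in> arr G" "dm G h = rn G j" "dm G j = rn G h" "cmp G j h = dm G h"
    by (auto simp: inverse_of_def composable_def)
  \<comment> \<open>The inverse \<open>j\<close> recovers \<open>z\<close> from \<open>c\<close>;
    its restriction to \<open>c\<close> cancels \<open>res h z\<close> in \<open>g\<close>, which
    recovers \<open>k\<close>.\<close>
  have act: "act j (act h z) = z"
    using SS2[of j h z] SS1[of z] yz j by (simp add: composable_def zs_defined_def)
  have res: "cmp G (res j (act h z)) (res h z) = dm X z"
    using SS7[of j h z] SS4[of z] yz j by (simp add: composable_def zs_defined_def)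
  have "res j (act h z) \<in> arr G" "dm G (res j (act h z)) = rn G (res h z)"
    using yz j by simp_all
  then have "cmp G (res j (act h z)) g = k"
    using yz j res G.rn_cmp_self[of k] by (simp add: G.assoc[symmetric] composable_def)
  then have "q = cmp P (dm G h, j) (c, g)" "composable P (dm G h, j) (c, g)"
    using act yz j mem(2) bc' X.rn_cmp_self[of z] by (auto simp: composable_P)
  moreover have "p = cmp P (b, dm X b) (rn G h, h)" "composable P (b, dm X b) (rn G h, h)"
    using yz SS3[of "rn G h"] SS5[of "rn G h"] X.cmp_dm[of y] by (auto simp: composable_P)
  ultimately show "\<exists>u v. inverse_of P u v \<and> composable P (b, dm X b) u \<and>
      p = cmp P (b, dm X b) u \<and> composable P v (c, g) \<and> q = cmp P v (c, g)"
    using inverse_of_P[OF inv] by blast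
qed

sublocale P: generalized_higher_rank_graph P "zs_size \<delta>"
proof
  fix p and m n :: "nat ^ 'k"
  assume p: "p \<in> arr P" and size: "zs_size \<delta> p = m + n"
  obtain x g where xg: "p = (x, g)" by (cases p)
  obtain b c where bc: "composable X b c" "x = cmp X b c" and [simp]: "m = \<delta> b" "n = \<delta> c"
    using X.unique_factorization[of x m n] p size xg by auto
  have mem: "x \<in> arr X" "g \<in> arr G" "dm X x = rn G g"
    using p xg by auto
  show "\<exists>a1 a2. composable P a1 a2 \<and> p = cmp P a1 a2 \<and> zs_size \<delta> a1 = m \<and> zs_size \<delta> a2 = n \<and>
         (\<forall>b1 b2. composable P b1 b2 \<and> p = cmp P b1 b2 \<and> zs_size \<delta> b1 = m \<and> zs_size \<delta> b2 = n \<longrightarrow>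
            (\<exists>g h. inverse_of P g h \<and> composable P a1 g \<and> b1 = cmp P a1 g \<and>
               composable P h a2 \<and> b2 = cmp P h a2))"
    by (rule exI[of _ "(b, dm X b)"], rule exI[of _ "(c, g)"])
      (use weak_factorization_P[OF mem bc] xg in auto)
qed

section \<open>The transversal and the \<R>-condition\<close>

definition maximal_generators :: "('a \<times> 'a) set" where
  "maximal_generators = {(x, dm X x) | x. x \<in> arr X \<and> maximal_at P (x, dm X x)}"

text \<open>Projecting an ideal of the product to first entries gives the ideal of \<open>x\<close>
  in \<open>X\<close>, since every \<open>w\<close> in the latter occurs in the pair
  \<open>(w, dm X w)\<close>. Ideals in \<open>X\<close> determine their generators.\<close>

lemma right_ideal_P_eq_iff:
  assumes "(x, g) \<in> arr P" "(y, h) \<in> arr P"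
  shows "right_ideal P (x, g) = right_ideal P (y, h) \<longleftrightarrow> x = y"
proof
  assume eq: "right_ideal P (x, g) = right_ideal P (y, h)"
  have "right_ideal X z \<subseteq> arr X" for z
    by (auto simp: right_ideal_def X.cmp_arr)
  then have fst_ideal: "right_ideal X z = fst ` right_ideal P (z, k)" if "(z, k) \<in> arr P" for z k
    unfolding right_ideal_P[OF that] by (force intro: rev_image_eqI[of "(w, dm X w)" for w])
  have "right_ideal X x = right_ideal X y"
    using fst_ideal[OF assms(1)] fst_ideal[OF assms(2)] eq by simp
  then show "x = y"
    using assms by (auto intro: X.right_ideal_inject)
qed (use assms in \<open>simp add: right_ideal_P\<close>)

text \<open>Replacing the second entry of \<open>(x, g)\<close> by \<open>dm X x\<close> changes
  neither the right ideal nor the range, so maximality carries over. Distinct first entries give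
  distinct ideals.\<close>

lemma transversal_maximal_generators: "transversal P maximal_generators"
  unfolding transversal_def
proof (intro conjI allI impI)
  show "maximal_generators \<subseteq> arr P" "\<forall>p \<in> maximal_generators. maximal_at P p"
    by (auto simp: maximal_generators_def)
next
  fix p assume max: "maximal_at P p"
  obtain x g where xg: "p = (x, g)" by (cases p)
  have mem: "(x, g) \<in> arr P" using max xg by (simp add: maximal_at_def)
  then have ideal: "right_ideal P (x, dm X x) = right_ideal P p"
    by (simp add: right_ideal_P_eq_iff xg)
  then have "maximal_at P (x, dm X x)"
    using max xg by (simp add: maximal_at_def)
  then show "\<exists>!q. q \<in> maximal_generators \<and> right_ideal P q = right_ideal P p"
    using mem ideal xg right_ideal_P_eq_iff
    by (intro ex1I[of _ "(x, dm X x)"]) (auto simp: maximal_generators_def)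
qed

text \<open>In a product of two such pairs, \<open>dm X x\<close> equals \<open>rn X y\<close>; it
  acts trivially on \<open>y\<close> and restricts to \<open>dm X y\<close>, so the form
  persists.\<close>

lemma wide_subcategory_maximal_generators:
  assumes "p \<in> wide_subcategory P maximal_generators"
  shows "\<exists>x \<in> arr X. p = (x, dm X x)"
  using assms
proof induction
  case (identity e)
  then show ?case
    by (auto simp: identities_P X.identitiesD)
next
  case (generator p)
  then show ?case
    by (auto simp: maximal_generators_def)
next
  case (product u v)
  then obtain x y where "x \<in> arr X" "u = (x, dm X x)" "y \<in> arr X" "v = (y, dm X y)"
    by auto
  then show ?case
    using product G.cmp_dm[of "dm X y"] by (auto simp: composable_P)
qed

lemma R_condition_P: "R_condition P"
  unfolding R_condition_def
proof (intro exI[of _ maximal_generators] conjI ballI allI impI)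
  show "transversal P maximal_generators"
    by (rule transversal_maximal_generators)
next
  fix u v p
  assume "u \<in> wide_subcategory P maximal_generators" "v \<in> wide_subcategory P maximal_generators"
    and p: "invertible P p \<and> composable P v p \<and> u = cmp P v p"
  then obtain x y where x: "x \<in> arr X" "u = (x, dm X x)" and y: "y \<in> arr X" "v = (y, dm X y)"
    by (auto dest!: wide_subcategory_maximal_generators)
  obtain z h where zh: "p = (z, h)" by (cases p)
  then have mem: "z \<in> arr X" "h \<in> arr G" "dm X z = rn G h" "dm X y = rn X z"
    using p y by (auto simp: composable_P)
  moreover have "z \<in> identities X"
    using p mem zh invertible_P_iff by simp
  ultimately have z: "z = dm X y" "rn G h = dm X y"
    using X.identitiesD[of z] by auto
  then have "cmp P v p = (y, h)"
    using y mem zh X.cmp_dm[of y] SS1[of z] SS4[of z] G.rn_cmp_self[of h] by simp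
  \<comment> \<open>The second entry of \<open>u\<close> is the identity \<open>dm X x\<close>, and
    this forces \<open>h\<close> to be an identity.\<close>
  then have "x = y" "h = dm X y"
    using p x by auto
  then show "u = v" "p \<in> identities P"
    using x y z zh X.identities_dm[of y] by (auto simp: identities_P)
qed

end

theorem proposition4p7:
  fixes X G :: "'a cat"
    and \<delta> :: "'a \<Rightarrow> nat ^ ('k::finite)"
    and act res :: "'a \<Rightarrow> 'a \<Rightarrow> 'a"
  assumes "higher_rank_graph X \<delta>"
    and "zappa_szep_action X G act res"
    and "size_preserving X G \<delta> act"
  shows "degree_functor (zs_product X G act res) (zs_size \<delta>) \<and>
         generalized_higher_rank_graph (zs_product X G act res) (zs_size \<delta>) \<and>
         R_condition (zs_product X G act res)"
proof -
  interpret size_preserving_action X G act res \<delta>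
    using assms by (intro size_preserving_action.intro size_preserving_action_axioms.intro)
  show ?thesis
    using P.degree_functor_axioms P.generalized_higher_rank_graph_axioms R_condition_P by blast
qed

end
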